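(* Let $L$ and $R$ be two oriented graphs. If $\operatorname{inv}(L) = 1$ and $\operatorname{inv}(R)=2$, then $\operatorname{inv}(L\rightarrow R) = 3$.
   Context: An oriented graph is a digraph with no loops, no multiple arcs and no directed cycle of length 2. Inverting a vertex set $X$ means reversing every arc with both ends in $X$. $\operatorname{inv}(D)$ is the minimum number of successive inversions needed to make the oriented graph $D$ acyclic. The dijoin $L\rightarrow R$ is obtained from the disjoint union of $L$ and $R$ by adding all arcs from $V(L)$ to $V(R)$. *)

theory Defs
  imports "Graph_Theory.Pair_Digraph"
begin

text \<open>
  In a \<^typ>\<open>'a pair_pre_digraph\<close> the arcs are ordered pairs of vertices, so there are no
  multiple arcs; \<^locale>\<open>pair_digraph\<close> adds well-formedness, finiteness and the absence of loops.
\<close>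

locale oriented_graph = pair_digraph +
  assumes no_two_cycle: "(u, v) \<in> parcs G \<Longrightarrow> (v, u) \<notin> parcs G"

definition invert :: "'a set \<Rightarrow> 'a pair_pre_digraph \<Rightarrow> 'a pair_pre_digraph" where
  "invert X D = D\<lparr>parcs :=
     {(u, v). (u, v) \<in> parcs D \<and> \<not> (u \<in> X \<and> v \<in> X)} \<union>
     {(v, u) | u v. (u, v) \<in> parcs D \<and> u \<in> X \<and> v \<in> X}\<rparr>"

text \<open>
  The minimum is over a nonempty set for every oriented graph; see
  \<open>oriented_graph.ex_decycling\<close> below.
\<close>

definition inversion_number :: "'a pair_pre_digraph \<Rightarrow> nat" where
  "inversion_number D = (LEAST k. \<exists>Xs. length Xs = k \<and> (\<forall>X \<in> set Xs. X \<subseteq> pverts D) \<and>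
     acyclic (parcs (fold invert Xs D)))"

definition dijoin ::
    "'a pair_pre_digraph \<Rightarrow> 'b pair_pre_digraph \<Rightarrow> ('a + 'b) pair_pre_digraph" where
  "dijoin L R = \<lparr>
     pverts = pverts L <+> pverts R,
     parcs = map_prod Inl Inl ` parcs L \<union> map_prod Inr Inr ` parcs R \<union>
       (Inl ` pverts L) \<times> (Inr ` pverts R)\<rparr>"

lemma pverts_invert [simp]: "pverts (invert X D) = pverts D"
  by (simp add: invert_def)

lemma in_parcs_invert:
  "(u, v) \<in> parcs (invert X D) \<longleftrightarrow>
     (if u \<in> X \<and> v \<in> X then (v, u) \<in> parcs D else (u, v) \<in> parcs D)"
  by (auto simp: invert_def)

lemma oriented_graphI:
  assumes "finite (pverts G)" "parcs G \<subseteq> pverts G \<times> pverts G"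
    and "\<And>u v. (u, v) \<in> parcs G \<Longrightarrow> (v, u) \<notin> parcs G"
  shows "oriented_graph G"
proof unfold_locales
  show "finite (parcs G)"
    using assms(1,2) by (meson finite_SigmaI finite_subset)
  show "fst e \<noteq> snd e" if "e \<in> parcs G" for e
    using assms(3) that by (metis prod.collapse)
qed (use assms in auto)

lemma (in oriented_graph) oriented_graph_invert: "oriented_graph (invert X G)"
  by (rule oriented_graphI)
    (auto simp: in_parcs_invert pair_finite_verts in_arcsD1 in_arcsD2 no_two_cycle
      split: if_splits)

lemma oriented_graph_dijoin:
  assumes "oriented_graph L" "oriented_graph R"
  shows "oriented_graph (dijoin L R)"
proof -
  interpret L: oriented_graph L by fact
  interpret R: oriented_graph R by fact
  show ?thesis
    by (rule oriented_graphI)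
      (auto simp: dijoin_def L.pair_finite_verts R.pair_finite_verts L.in_arcsD1 L.in_arcsD2
        R.in_arcsD1 R.in_arcsD2 L.no_two_cycle R.no_two_cycle)
qed

lemma (in oriented_graph) ex_decycling:
  "\<exists>Xs. (\<forall>X \<in> set Xs. X \<subseteq> pverts G) \<and> acyclic (parcs (fold invert Xs G))"
proof -
  obtain f :: "'a \<Rightarrow> nat" where f: "inj_on f (pverts G)"
    using finite_imp_inj_to_nat_seg[OF pair_finite_verts] by blast
  define B where "B D = {(u, v). (u, v) \<in> parcs D \<and> f v < f u}" for D :: "'a pair_pre_digraph"
  have "\<exists>Xs. (\<forall>X \<in> set Xs. X \<subseteq> pverts D) \<and> acyclic (parcs (fold invert Xs D))"
    if "oriented_graph D" "inj_on f (pverts D)" for D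
    using that
  proof (induction "card (B D)" arbitrary: D rule: less_induct)
    case less
    interpret D: oriented_graph D by fact
    have finB: "finite (B D)"
      by (rule finite_subset[OF _ D.pair_finite_arcs]) (auto simp: B_def)
    show ?case
    proof (cases "B D = {}")
      case True
      have "f u < f v" if "(u, v) \<in> parcs D" for u v
      proof -
        have "f u \<noteq> f v"
          using that less.prems(2) D.in_arcsD1 D.in_arcsD2 D.no_two_cycle
          by (metis inj_onD)
        moreover have "\<not> f v < f u"
          using True that by (auto simp: B_def)
        ultimately show ?thesis by simp
      qed
      then have "parcs D \<subseteq> measure f" by auto
      then have "acyclic (parcs D)"
        using wf_acyclic[OF wf_measure] acyclic_subset by blast
      then show ?thesis by (intro exI[of _ "[]"]) simp
    next
      case False
      then obtain a b where ab: "(a, b) \<in> parcs D" "f b < f a" by (auto simp: B_def)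
      let ?D = "invert {a, b} D"
      have "B ?D \<subseteq> B D - {(a, b)}"
        using ab D.no_two_cycle
        by (auto simp: B_def in_parcs_invert split: if_splits)
      moreover have "(a, b) \<in> B D" using ab by (simp add: B_def)
      ultimately have "card (B ?D) < card (B D)"
        using finB by (intro psubset_card_mono) auto
      then obtain Xs where "\<forall>X \<in> set Xs. X \<subseteq> pverts ?D" "acyclic (parcs (fold invert Xs ?D))"
        using less.hyps[of ?D] less.prems(2) D.oriented_graph_invert by auto
      then show ?thesis
        using ab D.in_arcsD1 D.in_arcsD2 by (intro exI[of _ "{a, b} # Xs"]) auto
    qed
  qed
  then show ?thesis using f oriented_graph_axioms by blast
qed

end

theory Submission
  imports Defs
begin

text \<open>
  Three inversions suffice: decycle \<open>L\<close> and \<open>R\<close> separately. Conversely, suppose that inverting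
  \<open>X\<close> and then \<open>Y\<close> makes \<open>L \<rightarrow> R\<close> acyclic. Give every vertex its type in the plane over the field
  with two elements, the pair of indicators of \<open>X\<close> and \<open>Y\<close>; an arc is reversed iff the dot product
  of the types of its ends is 1. If \<open>L\<close> has vertices of two distinct nonzero types, then the
  3-cycles through them that must be avoided leave so few arcs between different types in \<open>R\<close>
  that inverting the symmetric difference of \<open>X\<close> and \<open>Y\<close> alone makes \<open>R\<close> acyclic.
  If the only nonzero type in \<open>L\<close> is \<open>(1,1)\<close>, then no arc of \<open>L\<close> is reversed, so \<open>L\<close> is acyclic.
  If it is \<open>(1,0)\<close>, then a cycle of \<open>L\<close> has an arc from \<open>X\<close> to its complement, which closes a
  3-cycle with any vertex of \<open>R\<close> in \<open>X\<close>; hence \<open>X\<close> misses \<open>R\<close> and inverting \<open>Y\<close> alone makes \<open>R\<close>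
  acyclic.
\<close>

section \<open>Acyclic relations\<close>

text \<open>Along a path \<open>f\<close> never decreases, so a cycle would stay in one layer
  \<open>f = i\<close> and be a cycle of \<open>r i\<close>.\<close>

lemma acyclic_layered:
  fixes f :: "'a \<Rightarrow> 'b::order"
  assumes acyc: "\<And>i. acyclic (r i)"
    and step: "\<And>u v. (u, v) \<in> s \<Longrightarrow> f u < f v \<or> f u = f v \<and> (u, v) \<in> r (f u)"
  shows "acyclic s"
proof -
  have "f u < f v \<or> f u = f v \<and> (u, v) \<in> (r (f u))\<^sup>+" if "(u, v) \<in> s\<^sup>+" for u v
    using that
  proof (induction rule: trancl_induct)
    case (base v)
    then show ?case using step by blast
  next
    case (step v w)
    then show ?case
      using assms(2)[OF step.hyps(2)] by (auto intro: trancl_into_trancl)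
  qed
  then show ?thesis
    using acyc by (fastforce simp: acyclic_def)
qed

lemma acyclic_no_3_cycle:
  assumes "acyclic r" "(a, b) \<in> r" "(b, c) \<in> r"
  shows "(c, a) \<notin> r"
  using assms unfolding acyclic_def by (meson trancl.simps)

lemma acyclic_vimage_map_prod:
  assumes "acyclic r"
  shows "acyclic (map_prod f f -` r)"
proof -
  have "(f u, f v) \<in> r\<^sup>+" if "(u, v) \<in> (map_prod f f -` r)\<^sup>+" for u v
    using that by (induction rule: trancl_induct) (auto intro: trancl_into_trancl)
  then show ?thesis
    using assms by (auto simp: acyclic_def)
qed

section \<open>Inversions and dijoins\<close>

lemma invert_empty [simp]: "invert {} D = D"
  by (simp add: invert_def)

text \<open>The inequality of the two conjunctions expresses that the dot product of the types of
  \<open>u\<close> and \<open>v\<close> is 1.\<close>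

lemma in_parcs_invert_invert:
  "(u, v) \<in> parcs (invert Y (invert X D)) \<longleftrightarrow>
     (if (u \<in> X \<and> v \<in> X) \<noteq> (u \<in> Y \<and> v \<in> Y) then (v, u) \<in> parcs D else (u, v) \<in> parcs D)"
  by (auto simp: in_parcs_invert)

lemma invert_invert_commute: "invert Y (invert X D) = invert X (invert Y D)"
proof -
  have "parcs (invert Y (invert X D)) = parcs (invert X (invert Y D))"
    by (auto simp: in_parcs_invert)
  then show ?thesis
    by (simp add: invert_def)
qed

lemma pverts_dijoin [simp]: "pverts (dijoin L R) = pverts L <+> pverts R"
  by (simp add: dijoin_def)

lemma in_parcs_dijoin [simp]:
  "(Inl a, Inl b) \<in> parcs (dijoin L R) \<longleftrightarrow> (a, b) \<in> parcs L"
  "(Inr c, Inr d) \<in> parcs (dijoin L R) \<longleftrightarrow> (c, d) \<in> parcs R"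
  "(Inl a, Inr c) \<in> parcs (dijoin L R) \<longleftrightarrow> a \<in> pverts L \<and> c \<in> pverts R"
  "(Inr c, Inl a) \<notin> parcs (dijoin L R)"
  by (auto simp: dijoin_def intro: map_prod_imageI)

lemma pair_pre_digraph_eqI:
  fixes D D' :: "'a pair_pre_digraph"
  assumes "pverts D = pverts D'" "\<And>u v. (u, v) \<in> parcs D \<longleftrightarrow> (u, v) \<in> parcs D'"
  shows "D = D'"
  using assms by (intro pair_pre_digraph.equality) auto

lemma invert_Inl_dijoin: "invert (Inl ` A) (dijoin L R) = dijoin (invert A L) R"
proof (rule pair_pre_digraph_eqI)
  show "(u, v) \<in> parcs (invert (Inl ` A) (dijoin L R)) \<longleftrightarrow>
      (u, v) \<in> parcs (dijoin (invert A L) R)" for u v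
    by (cases u; cases v) (auto simp: in_parcs_invert)
qed simp

lemma invert_Inr_dijoin: "invert (Inr ` B) (dijoin L R) = dijoin L (invert B R)"
proof (rule pair_pre_digraph_eqI)
  show "(u, v) \<in> parcs (invert (Inr ` B) (dijoin L R)) \<longleftrightarrow>
      (u, v) \<in> parcs (dijoin L (invert B R))" for u v
    by (cases u; cases v) (auto simp: in_parcs_invert)
qed simp

lemma fold_invert_Inl_dijoin:
  "fold invert (map ((`) Inl) As) (dijoin L R) = dijoin (fold invert As L) R"
  by (induction As arbitrary: L) (simp_all add: invert_Inl_dijoin)

lemma fold_invert_Inr_dijoin:
  "fold invert (map ((`) Inr) Bs) (dijoin L R) = dijoin L (fold invert Bs R)"
  by (induction Bs arbitrary: R) (simp_all add: invert_Inr_dijoin)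

lemma acyclic_dijoin:
  assumes "acyclic (parcs L)" "acyclic (parcs R)"
  shows "acyclic (parcs (dijoin L R))"
proof -
  \<comment> \<open>Arcs between the sides only lead from \<open>L\<close> to \<open>R\<close>, so a
    path with both ends on one side stays there. Ends on different sides are included to carry the
    induction.\<close>
  have paths: "case (x, y) of (Inl a, Inl b) \<Rightarrow> (a, b) \<in> (parcs L)\<^sup>+
      | (Inr c, Inr d) \<Rightarrow> (c, d) \<in> (parcs R)\<^sup>+
      | (Inl _, Inr _) \<Rightarrow> True | (Inr _, Inl _) \<Rightarrow> False"
    if "(x, y) \<in> (parcs (dijoin L R))\<^sup>+" for x y
    using that
  proof (induction rule: trancl_induct)
    case (base y)
    then show ?case by (auto split: sum.splits)
  next
    case (step y z)
    show ?case
      using step.hyps(2) step.IH by (cases x; cases y; cases z) (auto intro: trancl_into_trancl)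
  qed
  have "(x, x) \<notin> (parcs (dijoin L R))\<^sup>+" for x
  proof
    assume "(x, x) \<in> (parcs (dijoin L R))\<^sup>+"
    from paths[OF this] show False
      using assms by (auto simp: acyclic_def split: sum.splits)
  qed
  then show ?thesis
    by (simp add: acyclic_def)
qed

section \<open>Subadditivity under the dijoin\<close>

lemma inversion_number_le:
  assumes "\<forall>X \<in> set Xs. X \<subseteq> pverts D" "acyclic (parcs (fold invert Xs D))"
  shows "inversion_number D \<le> length Xs"
  unfolding inversion_number_def using assms by (intro Least_le) blast

lemma (in oriented_graph) ex_inversions:
  obtains Xs where "length Xs = inversion_number G" "\<forall>X \<in> set Xs. X \<subseteq> pverts G"
    "acyclic (parcs (fold invert Xs G))"
proof -
  have "\<exists>k Xs. length Xs = k \<and> (\<forall>X \<in> set Xs. X \<subseteq> pverts G) \<and>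
      acyclic (parcs (fold invert Xs G))"
    using ex_decycling by blast
  from LeastI_ex[OF this] show ?thesis
    using that unfolding inversion_number_def by blast
qed

text \<open>Inverting a set on one side affects neither the other side nor the arcs between the
  sides.\<close>

lemma inversion_number_dijoin_le:
  assumes "oriented_graph L" "oriented_graph R"
  shows "inversion_number (dijoin L R) \<le> inversion_number L + inversion_number R"
proof -
  obtain As where As: "length As = inversion_number L" "\<forall>X \<in> set As. X \<subseteq> pverts L"
      "acyclic (parcs (fold invert As L))"
    using oriented_graph.ex_inversions[OF assms(1)] by blast
  obtain Bs where Bs: "length Bs = inversion_number R" "\<forall>X \<in> set Bs. X \<subseteq> pverts R"
      "acyclic (parcs (fold invert Bs R))"
    using oriented_graph.ex_inversions[OF assms(2)] by blast
  let ?Xs = "map ((`) Inl) As @ map ((`) Inr) Bs"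
  have "inversion_number (dijoin L R) \<le> length ?Xs"
    using As Bs
    by (intro inversion_number_le)
      (fastforce, simp add: fold_invert_Inl_dijoin fold_invert_Inr_dijoin acyclic_dijoin)
  then show ?thesis
    using As Bs by simp
qed

section \<open>Dijoins made acyclic by two inversions\<close>

locale decycled_dijoin = L: oriented_graph L + R: oriented_graph R
  for L :: "'a pair_pre_digraph" and R :: "'b pair_pre_digraph" +
  fixes X Y :: "('a + 'b) set"
  assumes acyclic_inverted: "acyclic (parcs (invert Y (invert X (dijoin L R))))"
begin

abbreviation "XL \<equiv> Inl -` X"
abbreviation "YL \<equiv> Inl -` Y"
abbreviation "XR \<equiv> Inr -` X"
abbreviation "YR \<equiv> Inr -` Y"
abbreviation "L' \<equiv> parcs (invert YL (invert XL L))"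
abbreviation "R' \<equiv> parcs (invert YR (invert XR R))"

text \<open>Exchanges the types (1,0) and (0,1), so that of two symmetric cases only one is proved
  directly.\<close>

lemma swapped: "decycled_dijoin L R Y X"
  by unfold_locales (use acyclic_inverted in \<open>simp add: invert_invert_commute[of X Y]\<close>)

lemma acyclic_L': "acyclic L'"
proof -
  have "L' = map_prod Inl Inl -` parcs (invert Y (invert X (dijoin L R)))"
    by (auto simp: in_parcs_invert)
  then show ?thesis
    using acyclic_vimage_map_prod[OF acyclic_inverted] by simp
qed

lemma acyclic_R': "acyclic R'"
proof -
  have "R' = map_prod Inr Inr -` parcs (invert Y (invert X (dijoin L R)))"
    by (auto simp: in_parcs_invert)
  then show ?thesis
    using acyclic_vimage_map_prod[OF acyclic_inverted] by simp
qed

text \<open>Both lemmas exclude a 3-cycle with two vertices on one side of the dijoin.\<close>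

lemma no_arc_R':
  assumes "l \<in> pverts L" "(r, r') \<in> R'"
    and "(l \<in> XL \<and> r' \<in> XR) \<noteq> (l \<in> YL \<and> r' \<in> YR)"
  shows "(l \<in> XL \<and> r \<in> XR) \<noteq> (l \<in> YL \<and> r \<in> YR)"
proof (rule ccontr)
  assume *: "\<not> ?thesis"
  have "r \<in> pverts R" "r' \<in> pverts R"
    using assms(2) R.in_arcsD1 R.in_arcsD2 by (auto simp: in_parcs_invert split: if_splits)
  then have "(Inl l, Inr r) \<in> parcs (invert Y (invert X (dijoin L R)))"
      "(Inr r', Inl l) \<in> parcs (invert Y (invert X (dijoin L R)))"
      "(Inr r, Inr r') \<in> parcs (invert Y (invert X (dijoin L R)))"
    using assms * by (auto simp: in_parcs_invert split: if_splits)
  then show False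
    using acyclic_no_3_cycle[OF acyclic_inverted] by blast
qed

lemma no_arc_L':
  assumes "r \<in> pverts R" "(l, l') \<in> L'"
    and "(l \<in> XL \<and> r \<in> XR) \<noteq> (l \<in> YL \<and> r \<in> YR)"
  shows "(l' \<in> XL \<and> r \<in> XR) \<noteq> (l' \<in> YL \<and> r \<in> YR)"
proof (rule ccontr)
  assume *: "\<not> ?thesis"
  have "l \<in> pverts L" "l' \<in> pverts L"
    using assms(2) L.in_arcsD1 L.in_arcsD2 by (auto simp: in_parcs_invert split: if_splits)
  then have "(Inl l', Inr r) \<in> parcs (invert Y (invert X (dijoin L R)))"
      "(Inr r, Inl l) \<in> parcs (invert Y (invert X (dijoin L R)))"
      "(Inl l, Inl l') \<in> parcs (invert Y (invert X (dijoin L R)))"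
    using assms * by (auto simp: in_parcs_invert split: if_splits)
  then show False
    using acyclic_no_3_cycle[OF acyclic_inverted] by blast
qed

lemma acyclic_R_if_L_disjoint_Y:
  assumes "pverts L \<inter> YL = {}" "\<not> acyclic (parcs L)"
  shows "acyclic (parcs (invert (pverts R \<inter> YR) R))"
proof -
  have XR: "r \<notin> XR" if "r \<in> pverts R" for r
  proof
    assume "r \<in> XR"
    \<comment> \<open>With \<open>r\<close> in \<open>XR\<close>, no arc of \<open>L\<close> leaves
      \<open>XL\<close>. As \<open>YL\<close> misses \<open>L\<close>, exactly the arcs within
      \<open>XL\<close> are reversed, so \<open>L\<close> agrees with the converse of
      \<open>L'\<close> inside \<open>XL\<close> and with \<open>L'\<close> outside.\<close>
    have "acyclic (parcs L)"
    proof (rule acyclic_layered[where f = "\<lambda>l. if l \<in> XL then 1 else (0::nat)"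
          and r = "\<lambda>i. if i = 1 then L'\<inverse> else L'"])
      fix u v
      assume uv: "(u, v) \<in> parcs L"
      then have "u \<notin> YL" "v \<notin> YL"
        using assms(1) L.in_arcsD1 L.in_arcsD2 by blast+
      have "v \<in> XL" if "u \<in> XL"
      proof (rule ccontr)
        assume "v \<notin> XL"
        with uv \<open>u \<notin> YL\<close> have "(u, v) \<in> L'"
          by (simp add: in_parcs_invert)
        then show False
          using no_arc_L'[OF \<open>r \<in> pverts R\<close>, of u v] that \<open>r \<in> XR\<close> \<open>u \<notin> YL\<close> \<open>v \<notin> XL\<close> \<open>v \<notin> YL\<close>
          by blast
      qed
      with uv \<open>u \<notin> YL\<close> show "(if u \<in> XL then 1 else 0) < (if v \<in> XL then 1 else (0::nat)) \<or>
          (if u \<in> XL then 1 else 0) = (if v \<in> XL then 1 else (0::nat)) \<and>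
          (u, v) \<in> (if (if u \<in> XL then 1 else (0::nat)) = 1 then L'\<inverse> else L')"
        by (cases "u \<in> XL"; cases "v \<in> XL") (simp_all add: in_parcs_invert)
    qed (use acyclic_L' in \<open>simp add: acyclic_converse\<close>)
    then show False
      using assms(2) by simp
  qed
  have "parcs (invert (pverts R \<inter> YR) R) = R'"
    using XR R.in_arcsD1 R.in_arcsD2 by (auto simp: in_parcs_invert split: if_splits)
  then show ?thesis
    using acyclic_R' by simp
qed

text \<open>All types are (0,0) or (1,1), and dot products among these vanish: the two inversions
  cancel on \<open>L\<close>.\<close>

lemma acyclic_L_if_same_type:
  assumes "\<And>l. l \<in> pverts L \<Longrightarrow> l \<in> XL \<longleftrightarrow> l \<in> YL"
  shows "acyclic (parcs L)"
proof -
  have "parcs L = L'"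
    using assms L.in_arcsD1 L.in_arcsD2 by (auto simp: in_parcs_invert split: if_splits)
  then show ?thesis
    using acyclic_L' by simp
qed

section \<open>Two distinct nonzero types in \<open>L\<close>\<close>

text \<open>The vertices of types (1,0) and (0,1), the types whose dot product with themselves is
  1.\<close>

definition symdiff_R :: "'b set" where
  "symdiff_R = {r \<in> pverts R. r \<in> XR \<longleftrightarrow> r \<notin> YR}"

lemma symdiff_R_subset: "symdiff_R \<subseteq> pverts R"
  by (auto simp: symdiff_R_def)

text \<open>The dot product of two distinct nonzero types is 1 iff one of them is (1,1), that is,
  iff inverting \<open>symdiff_R\<close> does not reverse the arc. On all other pairs of types both
  procedures agree.\<close>

lemma in_parcs_invert_symdiff_R:
  assumes "(u, v) \<in> parcs (invert symdiff_R R)"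
  shows "if (u \<in> XR \<or> u \<in> YR) \<and> (v \<in> XR \<or> v \<in> YR) \<and>
      ((u \<in> XR) \<noteq> (v \<in> XR) \<or> (u \<in> YR) \<noteq> (v \<in> YR)) then (v, u) \<in> R' else (u, v) \<in> R'"
proof -
  have uv: "u \<in> pverts R" "v \<in> pverts R"
    using assms R.in_arcsD1 R.in_arcsD2 by (auto simp: in_parcs_invert split: if_splits)
  show ?thesis
    using assms unfolding in_parcs_invert_invert
    unfolding in_parcs_invert symdiff_R_def mem_Collect_eq
    using uv by (cases "u \<in> XR"; cases "v \<in> XR"; cases "u \<in> YR"; cases "v \<in> YR") simp_all
qed

text \<open>
  Inside every type, inverting the symmetric difference agrees with \<open>R'\<close>; it therefore suffices
  to order the four types so that all arcs between different types go up.
\<close>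

lemma acyclic_invert_symdiff_R:
  fixes rank :: "bool \<Rightarrow> bool \<Rightarrow> nat"
  assumes "\<And>u v. (u, v) \<in> parcs (invert symdiff_R R) \<Longrightarrow>
      (u \<in> XR) \<noteq> (v \<in> XR) \<or> (u \<in> YR) \<noteq> (v \<in> YR) \<Longrightarrow>
      rank (u \<in> XR) (u \<in> YR) < rank (v \<in> XR) (v \<in> YR)"
  shows "acyclic (parcs (invert symdiff_R R))"
proof (rule acyclic_layered[where r = "\<lambda>_. R'" and f = "\<lambda>r. rank (r \<in> XR) (r \<in> YR)"])
  fix u v
  assume uv: "(u, v) \<in> parcs (invert symdiff_R R)"
  show "rank (u \<in> XR) (u \<in> YR) < rank (v \<in> XR) (v \<in> YR) \<or>
      rank (u \<in> XR) (u \<in> YR) = rank (v \<in> XR) (v \<in> YR) \<and> (u, v) \<in> R'"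
  proof (cases "(u \<in> XR) \<noteq> (v \<in> XR) \<or> (u \<in> YR) \<noteq> (v \<in> YR)")
    case True
    then show ?thesis using assms[OF uv] by blast
  next
    case False
    then have "(u, v) \<in> R'"
      using in_parcs_invert_symdiff_R[OF uv] by presburger
    then show ?thesis using False by simp
  qed
qed (rule acyclic_R')

text \<open>By \<open>a\<close> no arc of \<open>R'\<close> enters \<open>XR\<close> from outside,
  and by \<open>b\<close> none enters \<open>YR\<close>. So (1,0) and (0,1) are not joined, and no
  arc from a different type enters (1,1) or comes out of (0,0). Reversing the arcs between distinct
  nonzero types gives the order (1,0), (0,1), (1,1), (0,0).\<close>

lemma acyclic_R_if_10_01:
  assumes "a \<in> pverts L" "a \<in> XL" "a \<notin> YL" and "b \<in> pverts L" "b \<notin> XL" "b \<in> YL"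
  shows "acyclic (parcs (invert symdiff_R R))"
proof (rule acyclic_invert_symdiff_R[where
      rank = "\<lambda>x y. if x then (if y then 2 else 0) else (if y then 1 else 3)"])
  fix u v
  assume "(u, v) \<in> parcs (invert symdiff_R R)"
    and differ: "(u \<in> XR) \<noteq> (v \<in> XR) \<or> (u \<in> YR) \<noteq> (v \<in> YR)"
  note arc = in_parcs_invert_symdiff_R[OF this(1)]
  have X: "r \<in> XR" if "(r, r') \<in> R'" "r' \<in> XR" for r r'
    using no_arc_R'[OF assms(1) that(1)] that(2) assms(2,3) by blast
  have Y: "r \<in> YR" if "(r, r') \<in> R'" "r' \<in> YR" for r r'
    using no_arc_R'[OF assms(4) that(1)] that(2) assms(5,6) by blast
  show "(if u \<in> XR then (if u \<in> YR then 2 else 0) else (if u \<in> YR then 1 else 3))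
      < (if v \<in> XR then (if v \<in> YR then 2 else 0) else (if v \<in> YR then 1 else (3::nat)))"
    using arc differ X[of u v] X[of v u] Y[of u v] Y[of v u]
    by (smt (verit) zero_less_numeral one_less_numeral_iff numeral_less_iff semiring_norm
        zero_less_one)
qed

text \<open>By \<open>b\<close> no arc of \<open>R'\<close> enters the union of the types (1,0) and
  (0,1) from outside. Now (1,1) and (0,1) are not joined, and (1,0) is the type that no arc of
  \<open>R'\<close> from another type enters.\<close>

lemma acyclic_R_if_10_11:
  assumes "a \<in> pverts L" "a \<in> XL" "a \<notin> YL" and "b \<in> pverts L" "b \<in> XL" "b \<in> YL"
  shows "acyclic (parcs (invert symdiff_R R))"
proof (rule acyclic_invert_symdiff_R[where
      rank = "\<lambda>x y. if x then (if y then 0 else 2) else (if y then 1 else 3)"])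
  fix u v
  assume "(u, v) \<in> parcs (invert symdiff_R R)"
    and differ: "(u \<in> XR) \<noteq> (v \<in> XR) \<or> (u \<in> YR) \<noteq> (v \<in> YR)"
  note arc = in_parcs_invert_symdiff_R[OF this(1)]
  have X: "r \<in> XR" if "(r, r') \<in> R'" "r' \<in> XR" for r r'
    using no_arc_R'[OF assms(1) that(1)] that(2) assms(2,3) by blast
  have XY: "(r \<in> XR) \<noteq> (r \<in> YR)" if "(r, r') \<in> R'" "(r' \<in> XR) \<noteq> (r' \<in> YR)" for r r'
    using no_arc_R'[OF assms(4) that(1)] that(2) assms(5,6) by blast
  show "(if u \<in> XR then (if u \<in> YR then 0 else 2) else (if u \<in> YR then 1 else 3))
      < (if v \<in> XR then (if v \<in> YR then 0 else 2) else (if v \<in> YR then 1 else (3::nat)))"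
    using arc differ X[of u v] X[of v u] XY[of u v] XY[of v u]
    by (smt (verit) zero_less_numeral one_less_numeral_iff numeral_less_iff semiring_norm
        zero_less_one)
qed

lemma ex_inversion_R:
  assumes "\<not> acyclic (parcs L)"
  shows "\<exists>Z \<subseteq> pverts R. acyclic (parcs (invert Z R))"
proof -
  interpret swap: decycled_dijoin L R Y X
    by (rule swapped)
  let ?T10 = "\<exists>l \<in> pverts L. l \<in> XL \<and> l \<notin> YL"
  let ?T01 = "\<exists>l \<in> pverts L. l \<notin> XL \<and> l \<in> YL"
  let ?T11 = "\<exists>l \<in> pverts L. l \<in> XL \<and> l \<in> YL"
  \<comment> \<open>In the first three cases two distinct nonzero types occur in \<open>L\<close>;
    in the last three at most one does, possibly none.\<close>
  consider "?T10" "?T01" | "?T10" "?T11" | "?T01" "?T11" | "\<not> ?T01" "\<not> ?T11"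
    | "\<not> ?T10" "\<not> ?T11" | "\<not> ?T10" "\<not> ?T01"
    by argo
  then show ?thesis
  proof cases
    case 1
    then have "acyclic (parcs (invert symdiff_R R))"
      using acyclic_R_if_10_01 by blast
    then show ?thesis using symdiff_R_subset by blast
  next
    case 2
    then have "acyclic (parcs (invert symdiff_R R))"
      using acyclic_R_if_10_11 by blast
    then show ?thesis using symdiff_R_subset by blast
  next
    case 3
    then have "acyclic (parcs (invert swap.symdiff_R R))"
      using swap.acyclic_R_if_10_11 by blast
    then show ?thesis using swap.symdiff_R_subset by blast
  next
    case 4
    then have "pverts L \<inter> YL = {}" by blast
    then show ?thesis
      using acyclic_R_if_L_disjoint_Y[OF _ assms] by blast
  next
    case 5
    then have "pverts L \<inter> XL = {}" by blast
    then show ?thesis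
      using swap.acyclic_R_if_L_disjoint_Y[OF _ assms] by blast
  next
    case 6
    then show ?thesis
      using acyclic_L_if_same_type assms by blast
  qed
qed

end

theorem theorem3p4:
  fixes L :: "'a pair_pre_digraph" and R :: "'b pair_pre_digraph"
  assumes "oriented_graph L" and "oriented_graph R"
    and "inversion_number L = 1" and "inversion_number R = 2"
  shows "inversion_number (dijoin L R) = 3"
proof (rule antisym)
  show "inversion_number (dijoin L R) \<le> 3"
    using inversion_number_dijoin_le[OF assms(1,2)] assms(3,4) by simp
  show "3 \<le> inversion_number (dijoin L R)"
  proof (rule ccontr)
    assume "\<not> 3 \<le> inversion_number (dijoin L R)"
    moreover obtain Xs where Xs: "length Xs = inversion_number (dijoin L R)"
        "acyclic (parcs (fold invert Xs (dijoin L R)))"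
      using oriented_graph.ex_inversions[OF oriented_graph_dijoin[OF assms(1,2)]] by metis
    ultimately have "length Xs = 0 \<or> length Xs = Suc 0 \<or> length Xs = Suc (Suc 0)"
      by linarith
    then consider "Xs = []" | X where "Xs = [X]" | X Y where "Xs = [X, Y]"
      by (auto simp: length_Suc_conv)
    \<comment> \<open>Shorter lists are padded with the empty set, whose inversion changes
      nothing.\<close>
    then obtain X Y where "acyclic (parcs (invert Y (invert X (dijoin L R))))"
    proof cases
      case 1
      then show ?thesis using Xs(2) that[of "{}" "{}"] by simp
    next
      case (2 X)
      then show ?thesis using Xs(2) that[of "{}" X] by simp
    next
      case (3 X Y)
      then show ?thesis using Xs(2) that[of Y X] by simp
    qed
    then have "decycled_dijoin L R X Y"
      using assms(1,2) by (simp add: decycled_dijoin_def decycled_dijoin_axioms_def)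
    moreover have "\<not> acyclic (parcs L)"
      using inversion_number_le[of "[]" L] assms(3) by auto
    ultimately obtain Z where "Z \<subseteq> pverts R" "acyclic (parcs (invert Z R))"
      using decycled_dijoin.ex_inversion_R by blast
    then show False
      using inversion_number_le[of "[Z]" R] assms(4) by simp
  qed
qed

end
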